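(* Let $k,n$ be positive integers with $k\le n$. Then $F(k,n)=k$.
   Context: Clear Mastermind with $n\ge 1$ positions and $k\ge 1$ codes: write $[k]=\{1,\dots,k\}$. A codemaker fixes a secret answer $y=(y_1,\dots,y_n)\in[k]^n$. In each round the codebreaker submits a guess $x\in[k]^n$ (any string, chosen adaptively from previous guesses and feedback) and receives feedback $\pi(x,y)\in\{\mathrm{G},\mathrm{Y},\mathrm{B}\}^n$ defined as follows: for every position $i$ with $x_i=y_i$, $\pi_i=\mathrm{G}$. Let $M$ be the multiset $\{y_i : x_i\ne y_i\}$ of answer codes at non-G positions. Then scan the non-G positions $j$ in increasing order: if $x_j$ currently occurs in $M$, set $\pi_j=\mathrm{Y}$ and remove one copy of $x_j$ from $M$; otherwise set $\pi_j=\mathrm{B}$. (E.g. answer $(2,1,3,4,2)$, guess $(2,2,2,2,4)$ gives $(\mathrm{G},\mathrm{Y},\mathrm{B},\mathrm{B},\mathrm{Y})$; answer $(1,1,2,3,3)$, guess $(1,1,1,2,3)$ gives $(\mathrm{G},\mathrm{G},\mathrm{B},\mathrm{Y},\mathrm{G})$.) The codebreaker finds the answer in $m$ rounds if her $m$-th guess equals $y$. $F(k,n)$ is the least $m$ such that the codebreaker has a strategy that, for every answer $y\in[k]^n$, makes a guess equal to $y$ within the first $m$ rounds. *)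

theory Defs
  imports Main "HOL-Library.Multiset"
begin

definition codewords :: "nat \<Rightarrow> nat \<Rightarrow> nat list set" where
  "codewords k n = {x. length x = n \<and> set x \<subseteq> {1..k}}"

datatype colour = Green | Yellow | Black

text \<open>
  The list of pairs runs through the positions \<open>(x\<^sub>i, y\<^sub>i)\<close> in increasing order. The multiset
  holds the answer codes at the non-green positions that have not yet been used up by a
  yellow mark.
\<close>

fun scan :: "nat multiset \<Rightarrow> (nat \<times> nat) list \<Rightarrow> colour list" where
  "scan M [] = []"
| "scan M ((a, b) # ps) =
     (if a = b then Green # scan M ps
      else if a \<in># M then Yellow # scan (M - {#a#}) ps
      else Black # scan M ps)"

text \<open>The guess is the first argument, the answer the second.\<close>

definition feedback :: "nat list \<Rightarrow> nat list \<Rightarrow> colour list" where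
  "feedback x y =
     scan (mset (map snd (filter (\<lambda>(a, b). a \<noteq> b) (zip x y)))) (zip x y)"

lemma "feedback [2, 2, 2, 2, 4] [2, 1, 3, 4, 2] = [Green, Yellow, Black, Black, Yellow]"
  by (simp add: feedback_def)

lemma "feedback [1, 1, 1, 2, 3] [1, 1, 2, 3, 3] = [Green, Green, Black, Yellow, Green]"
  by (simp add: feedback_def)

text \<open>Past rounds in chronological order, each with its guess and the feedback received.\<close>

type_synonym history = "(nat list \<times> colour list) list"

type_synonym strategy = "history \<Rightarrow> nat list"

definition is_strategy :: "nat \<Rightarrow> nat \<Rightarrow> strategy \<Rightarrow> bool" where
  "is_strategy k n S \<longleftrightarrow> (\<forall>h. S h \<in> codewords k n)"

fun play :: "strategy \<Rightarrow> nat list \<Rightarrow> nat \<Rightarrow> history" where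
  "play S y 0 = []"
| "play S y (Suc t) =
     (let h = play S y t; x = S h in h @ [(x, feedback x y)])"

text \<open>The guess in round \<open>t + 1\<close>, made after \<open>t\<close> completed rounds.\<close>

definition guess :: "strategy \<Rightarrow> nat list \<Rightarrow> nat \<Rightarrow> nat list" where
  "guess S y t = S (play S y t)"

definition solves_within :: "nat \<Rightarrow> nat \<Rightarrow> nat \<Rightarrow> strategy \<Rightarrow> bool" where
  "solves_within k n m S \<longleftrightarrow> (\<forall>y \<in> codewords k n. \<exists>t < m. guess S y t = y)"

definition F :: "nat \<Rightarrow> nat \<Rightarrow> nat" where
  "F k n = (LEAST m. \<exists>S. is_strategy k n S \<and> solves_within k n m S)"

text \<open>For \<open>k \<ge> 1\<close> the minimum is over a nonempty set: guess all codewords in turn.\<close>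

lemma ex_solving_strategy:
  assumes "k \<ge> 1"
  shows "\<exists>m S. is_strategy k n S \<and> solves_within k n m S"
proof -
  have "finite (codewords k n)"
    unfolding codewords_def
    by (rule finite_subset[OF _ finite_lists_length_eq[of "{1..k}" n]]) auto
  then obtain xs where xs: "set xs = codewords k n"
    using finite_list by blast
  have "replicate n 1 \<in> codewords k n"
    using assms unfolding codewords_def by (cases n) auto
  then have ne: "length xs > 0"
    using xs by (cases xs) auto
  define S :: strategy where "S = (\<lambda>h. xs ! (length h mod length xs))"
  have len: "length (play S y t) = t" for y t
    by (induction t) (simp_all add: Let_def)
  have "is_strategy k n S"
    unfolding is_strategy_def S_def xs[symmetric]
    using ne by (intro allI nth_mem mod_less_divisor)
  moreover have "solves_within k n (length xs) S"
    unfolding solves_within_def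
  proof
    fix y assume "y \<in> codewords k n"
    then obtain t where "t < length xs" "xs ! t = y"
      using xs by (metis in_set_conv_nth)
    then show "\<exists>t < length xs. guess S y t = y"
      using len[of y t] by (intro exI[of _ t]) (simp add: guess_def S_def)
  qed
  ultimately show ?thesis
    by blast
qed

end

theory Submission
  imports Defs "HOL-Combinatorics.Permutations"
begin

text \<open>
  Upper bound: the monochromatic guesses with the codes \<open>1, \<dots>, k - 1\<close> determine the answer, which
  is then guess number \<open>k\<close>.

  Lower bound: the codemaker only rearranges a fixed surjection \<open>\<sigma>\<close> of the positions onto the codes,
  so that the feedback depends on the green positions alone. Let \<open>L\<^sub>i\<close> be the set of codes not yet
  guessed at position \<open>i\<close>. He maintains a nonempty set \<open>P\<close> of positions with
  \<open>\<sigma> i \<in> L\<^sub>i \<subseteq> \<sigma> ` P\<close> for all \<open>i \<in> P\<close>. When \<open>x\<close> is guessed, he rearranges \<open>\<sigma>\<close> inside \<open>P\<close>,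
  compatibly with \<open>L\<close>, so that as few positions of \<open>P\<close> as possible turn green, and replaces \<open>P\<close> by a
  minimal nonempty subset \<open>P'\<close> with \<open>L\<^sub>i - {x\<^sub>i} \<subseteq> \<sigma> ` P'\<close> for all \<open>i \<in> P'\<close>. By minimality the digraph
  on \<open>P'\<close> with an edge from \<open>i\<close> to \<open>j\<close> whenever \<open>\<sigma> j \<in> L\<^sub>i - {x\<^sub>i}\<close> is strongly connected. A green
  position in \<open>P'\<close> would thus lie on a cycle, and moving the codes along this cycle would reduce the
  number of green positions. As long as at most \<open>k - 1\<close> guesses have been made, all \<open>L\<^sub>i\<close> are nonempty
  and the invariant survives; hence no guess was correct.
\<close>

section \<open>Feedback\<close>

lemma scan_cong:
  assumes "length x = length y" "length y = length z"
    and "\<And>i. i < length x \<Longrightarrow> x ! i = y ! i \<longleftrightarrow> x ! i = z ! i"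
  shows "scan M (zip x y) = scan M (zip x z)"
  using assms
proof (induction x y z arbitrary: M rule: list_induct3)
  case (Cons a x b y c z)
  have "x ! i = y ! i \<longleftrightarrow> x ! i = z ! i" if "i < length x" for i
    using Cons.prems[of "Suc i"] that by simp
  moreover have "a = b \<longleftrightarrow> a = c"
    using Cons.prems[of 0] by simp
  ultimately show ?case
    using Cons.IH by simp
qed auto

lemma mset_matches_cong:
  assumes "length x = length y" "length y = length z"
    and "\<And>i. i < length x \<Longrightarrow> x ! i = y ! i \<longleftrightarrow> x ! i = z ! i"
  shows "mset (map snd (filter (\<lambda>(a, b). a = b) (zip x y))) =
         mset (map snd (filter (\<lambda>(a, b). a = b) (zip x z)))"
  using assms
proof (induction x y z rule: list_induct3)
  case (Cons a x b y c z)
  have "x ! i = y ! i \<longleftrightarrow> x ! i = z ! i" if "i < length x" for i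
    using Cons.prems[of "Suc i"] that by simp
  moreover have "a = b \<longleftrightarrow> a = c"
    using Cons.prems[of 0] by simp
  ultimately show ?case
    using Cons.IH by auto
qed auto

lemma mset_matches_mismatches:
  assumes "length x = length y"
  shows "mset (map snd (filter (\<lambda>(a, b). a = b) (zip x y))) +
         mset (map snd (filter (\<lambda>(a, b). a \<noteq> b) (zip x y))) = mset y"
  using assms by (induction x y rule: list_induct2) auto

text \<open>The green positions and the guess determine the matched codes, so equal multisets of
  codes leave equal multisets for the yellow marks. Beyond that, \<open>scan\<close> sees the answer
  only through the test for green.\<close>

lemma feedback_cong:
  assumes "length x = length y" "length y = length z" "mset y = mset z"
    and "\<And>i. i < length x \<Longrightarrow> x ! i = y ! i \<longleftrightarrow> x ! i = z ! i"
  shows "feedback x y = feedback x z"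
proof -
  have "mset (map snd (filter (\<lambda>(a, b). a \<noteq> b) (zip x y))) =
        mset (map snd (filter (\<lambda>(a, b). a \<noteq> b) (zip x z)))"
    using mset_matches_mismatches[OF assms(1)] mset_matches_mismatches[of x z]
      mset_matches_cong[OF assms(1,2,4)] assms(1-3) by (metis add_left_cancel)
  then show ?thesis
    unfolding feedback_def using scan_cong[OF assms(1,2,4)] by simp
qed

lemma scan_nth_Green_iff:
  "i < length ps \<Longrightarrow> scan M ps ! i = Green \<longleftrightarrow> fst (ps ! i) = snd (ps ! i)"
  by (induction M ps arbitrary: i rule: scan.induct) (auto simp: nth_Cons split: nat.split)

lemma feedback_nth_Green_iff:
  assumes "i < length x" "i < length y"
  shows "feedback x y ! i = Green \<longleftrightarrow> x ! i = y ! i"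
  using assms by (simp add: feedback_def scan_nth_Green_iff)

lemma length_play [simp]: "length (play S y t) = t"
  by (induction t) (simp_all add: Let_def)

lemma play_cong:
  assumes "\<And>s. s < t \<Longrightarrow> feedback (guess S y s) y = feedback (guess S y s) z"
  shows "play S y t = play S z t"
  using assms
proof (induction t)
  case (Suc t)
  then have "play S y t = play S z t"
    by simp
  then show ?case
    using Suc.prems[of t] by (simp add: Let_def guess_def)
qed simp

lemma set_play: "set (play S y t) = (\<lambda>s. (guess S y s, feedback (guess S y s) y)) ` {..<t}"
  by (induction t) (simp_all add: Let_def guess_def lessThan_Suc)

section \<open>The upper bound\<close>

text \<open>A position carrying none of the codes below \<open>k\<close> must carry
  \<open>k\<close>, so \<open>k\<close> itself never has to be tested.\<close>

lemma codeword_eqI: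
  assumes "y \<in> codewords k n" "z \<in> codewords k n"
    and "\<And>c i. c \<in> {1..<k} \<Longrightarrow> i < n \<Longrightarrow> y ! i = c \<longleftrightarrow> z ! i = c"
  shows "y = z"
proof (rule nth_equalityI)
  fix i assume "i < length y"
  then have "i < n" "y ! i \<in> {1..k}" "z ! i \<in> {1..k}"
    using assms(1,2) by (auto simp: codewords_def subset_iff)
  then show "y ! i = z ! i"
    using assms(3)[of "y ! i" i] assms(3)[of "z ! i" i]
    by (cases "y ! i < k"; cases "z ! i < k") auto
qed (use assms in \<open>simp add: codewords_def\<close>)

lemma monochromatic_strategy:
  assumes "k \<ge> 1"
  shows "\<exists>S. is_strategy k n S \<and> solves_within k n k S"
proof -
  define cons where
    "cons h z \<longleftrightarrow> z \<in> codewords k n \<and> (\<forall>(x, f) \<in> set h. feedback x z = f)" for h z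
  \<comment> \<open>After \<open>s < k - 1\<close> rounds, code \<open>s + 1\<close> is guessed
    everywhere; from then on, any answer consistent with the history. The last default only keeps
    guesses legal on histories that no answer produces.\<close>
  define S :: strategy where
    "S h = (if length h < k - 1 then replicate n (Suc (length h))
            else if \<exists>z. cons h z then SOME z. cons h z else replicate n 1)" for h
  have mono: "replicate n c \<in> codewords k n" if "c \<in> {1..k}" for c
    using that by (auto simp: codewords_def)
  have guess_mono: "guess S y s = replicate n (Suc s)" if "s < k - 1" for y s
    using that by (simp add: guess_def S_def)
  have "S h \<in> codewords k n" for h
  proof -
    have "(SOME z. cons h z) \<in> codewords k n" if "\<exists>z. cons h z"
      using someI_ex[OF that] by (simp add: cons_def)
    then show ?thesis
      using mono assms by (simp add: S_def)
  qed
  then have "is_strategy k n S"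
    by (simp add: is_strategy_def)
  moreover have "guess S y (k - 1) = y" if y: "y \<in> codewords k n" for y
  proof -
    define h where "h = play S y (k - 1)"
    have "cons h y"
      using y by (auto simp: cons_def h_def set_play)
    then have z: "cons h (S h)"
      unfolding S_def by (auto simp: h_def intro: someI)
    have "y = S h"
    proof (rule codeword_eqI[OF y])
      show "S h \<in> codewords k n"
        using z by (simp add: cons_def)
      fix c i assume "c \<in> {1..<k}" "i < n"
      then obtain s where s: "s < k - 1" "c = Suc s"
        by (intro that[of "c - 1"]) auto
      then have "feedback (replicate n c) (S h) = feedback (replicate n c) y"
        using z by (auto simp: cons_def h_def set_play guess_mono)
      moreover have "length y = n" "length (S h) = n"
        using y z by (simp_all add: cons_def codewords_def)
      ultimately show "y ! i = c \<longleftrightarrow> S h ! i = c"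
        using feedback_nth_Green_iff[of i "replicate n c" y]
          feedback_nth_Green_iff[of i "replicate n c" "S h"] \<open>i < n\<close> by auto
    qed
    then show ?thesis
      by (simp add: guess_def h_def)
  qed
  ultimately show ?thesis
    using assms unfolding solves_within_def
    by (intro exI[of _ S] conjI ballI exI[of _ "k - 1"]) auto
qed

section \<open>The lower bound\<close>

text \<open>A shortest closed walk through \<open>g\<close> repeats no vertex, so sending each of
  its vertices to the next and fixing all others is a permutation.\<close>

lemma permutation_along_cycle:
  assumes "(g, g) \<in> R\<^sup>+" "R \<subseteq> A \<times> A"
  shows "\<exists>q. q permutes A \<and> (g, q g) \<in> R \<and> (\<forall>i. q i = i \<or> (i, q i) \<in> R)"
proof -
  define N where "N = (LEAST N. 0 < N \<and> (g, g) \<in> R ^^ N)"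
  have N: "0 < N" "(g, g) \<in> R ^^ N"
    using LeastI_ex[of "\<lambda>N. 0 < N \<and> (g, g) \<in> R ^^ N"] assms(1)
    by (auto simp: N_def trancl_power)
  have N_le: "N \<le> m" if "0 < m" "(g, g) \<in> R ^^ m" for m
    unfolding N_def using that by (intro Least_le) simp
  obtain f where f: "f 0 = g" "f N = g" "\<And>i. i < N \<Longrightarrow> (f i, f (Suc i)) \<in> R"
    using N(2) by (auto simp: relpow_fun_conv)
  \<comment> \<open>Cutting out the stretch from \<open>a\<close> to \<open>b\<close> leaves a
    shorter closed walk, still of positive length since \<open>b < N\<close>.\<close>
  have shortcut: False if "a < b" "b < N" "f a = f b" for a b
  proof -
    have "(g, f a) \<in> R ^^ a"
      using f that by (auto simp: relpow_fun_conv intro!: exI[of _ f])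
    moreover have "(f b, g) \<in> R ^^ (N - b)"
      unfolding relpow_fun_conv
      using f that by (intro exI[of _ "\<lambda>i. f (b + i)"]) auto
    ultimately have "(g, g) \<in> R ^^ (a + (N - b))"
      using that(3) by (auto simp: relpow_add)
    then show False
      using N_le[of "a + (N - b)"] that by auto
  qed
  have inj: "inj_on f {..<N}"
    by (rule linorder_inj_onI) (use shortcut in auto)
  define C where "C = f ` {..<N}"
  define q where "q i = (if i \<in> C then f (Suc (inv_into {..<N} f i)) else i)" for i
  have q_f: "q (f s) = f (Suc s)" if "s < N" for s
    using that inj by (simp add: q_def C_def)
  have f_Suc: "f (Suc s) \<in> C" if "s < N" for s
    using f N that by (cases "Suc s = N") (auto simp: C_def intro: rev_image_eqI[of 0])
  \<comment> \<open>The shifted index can reach \<open>N\<close>, where \<open>f N = f 0\<close>;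
    that case compares with index \<open>0\<close> instead.\<close>
  have Suc_neq: "f (Suc s) \<noteq> f (Suc t)" if "s < t" "t < N" for s t
    using that f shortcut[of "Suc s" "Suc t"] shortcut[of 0 "Suc s"] by (cases "Suc t = N") auto
  have "inj_on (q \<circ> f) {..<N}"
    by (rule linorder_inj_onI) (use Suc_neq q_f in auto)
  then have "inj_on q C"
    using inj_on_imageI by (auto simp: C_def)
  moreover have "q ` C \<subseteq> C"
    using q_f f_Suc by (auto simp: C_def)
  ultimately have "bij_betw q C C"
    by (simp add: bij_betw_def C_def endo_inj_surj)
  then have "q permutes C"
    by (rule bij_imp_permutes) (simp add: q_def)
  moreover have "C \<subseteq> A"
    using f(3) assms(2) by (auto simp: C_def)
  moreover have "(g, q g) \<in> R"
    using q_f[of 0] f(1) f(3)[of 0] N(1) by simp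
  moreover have "q i = i \<or> (i, q i) \<in> R" for i
    using q_f f(3) by (cases "i \<in> C") (auto simp: C_def q_def)
  ultimately show ?thesis
    using permutes_subset by blast
qed

text \<open>One round of the codemaker: \<open>L i\<close> holds the codes not yet guessed at
  \<open>i\<close>, \<open>x\<close> is the new guess and \<open>p\<close> the rearrangement.
  Keeping \<open>\<sigma> (p i)\<close> in \<open>L i\<close> ensures that no earlier green mark
  changes.\<close>

lemma rearrangement_step:
  fixes \<sigma> :: "'a \<Rightarrow> 'b" and L :: "'a \<Rightarrow> 'b set" and x :: "'a \<Rightarrow> 'b"
  assumes "finite P" "P \<noteq> {}"
    and L: "\<And>i. i \<in> P \<Longrightarrow> \<sigma> i \<in> L i" "\<And>i. i \<in> P \<Longrightarrow> L i \<subseteq> \<sigma> ` P"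
    and ne: "\<And>i. i \<in> P \<Longrightarrow> L i - {x i} \<noteq> {}"
  shows "\<exists>p P'. p permutes P \<and> (\<forall>i \<in> P. \<sigma> (p i) \<in> L i) \<and> P' \<subseteq> P \<and> P' \<noteq> {} \<and>
           (\<forall>i \<in> P'. \<sigma> (p i) \<noteq> x i \<and> L i - {x i} \<subseteq> (\<lambda>j. \<sigma> (p j)) ` P')"
proof -
  define adm where "adm p \<longleftrightarrow> p permutes P \<and> (\<forall>i \<in> P. \<sigma> (p i) \<in> L i)" for p
  define hits where "hits p = {i \<in> P. \<sigma> (p i) = x i}" for p
  have "adm id"
    using L(1) by (simp add: adm_def permutes_id)
  then obtain p where p: "adm p" and p_min: "\<And>q. adm q \<Longrightarrow> card (hits p) \<le> card (hits q)"
    using ex_has_least_nat[of adm id "\<lambda>p. card (hits p)"] by blast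
  define \<tau> where "\<tau> i = \<sigma> (p i)" for i
  have \<tau>_P: "\<tau> ` P = \<sigma> ` P"
    using p unfolding adm_def \<tau>_def by (metis image_image permutes_image)
  define closed where
    "closed Q \<longleftrightarrow> Q \<subseteq> P \<and> Q \<noteq> {} \<and> (\<forall>i \<in> Q. L i - {x i} \<subseteq> \<tau> ` Q)" for Q
  have "closed P"
    using L(2) \<tau>_P assms(2) by (auto simp: closed_def)
  then obtain P' where P': "closed P'" and P'_min: "\<And>Q. closed Q \<Longrightarrow> card P' \<le> card Q"
    using ex_has_least_nat[of closed P card] by blast
  have P'_P: "P' \<subseteq> P" and fin: "finite P'"
    using P' assms(1) finite_subset by (auto simp: closed_def)
  have "\<tau> g \<noteq> x g" if g: "g \<in> P'" for g
  proof
    assume hit: "\<tau> g = x g"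
    define R where "R = {(i, j). i \<in> P' \<and> j \<in> P' \<and> \<tau> j \<in> L i - {x i}}"
    \<comment> \<open>The transitive closure without reflexivity: once \<open>Q\<close> is all of
      \<open>P'\<close>, membership of \<open>g\<close> yields a genuine cycle.\<close>
    define Q where "Q = R\<^sup>+ `` {g}"
    have succ: "L i - {x i} \<subseteq> \<tau> ` (R `` {i})" if i: "i \<in> P'" for i
    proof
      fix c assume c: "c \<in> L i - {x i}"
      then obtain j where "j \<in> P'" "c = \<tau> j"
        using P' i unfolding closed_def by blast
      then show "c \<in> \<tau> ` (R `` {i})"
        using i c by (auto simp: R_def)
    qed
    have "R\<^sup>+ \<subseteq> P' \<times> P'"
      by (rule trancl_subset_Sigma) (auto simp: R_def)
    then have Q_P': "Q \<subseteq> P'"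
      by (auto simp: Q_def)
    have "R `` {g} \<noteq> {}"
      using succ[OF g] ne[of g] g P'_P by blast
    then have "Q \<noteq> {}"
      by (auto simp: Q_def)
    moreover have "L i - {x i} \<subseteq> \<tau> ` Q" if "i \<in> Q" for i
    proof -
      have "R `` {i} \<subseteq> Q"
        using that by (auto simp: Q_def intro: trancl_into_trancl)
      then show ?thesis
        using succ[of i] that Q_P' by blast
    qed
    ultimately have "closed Q"
      using Q_P' P'_P by (simp add: closed_def)
    then have "Q = P'"
      using P'_min Q_P' fin by (intro card_seteq) auto
    then have "(g, g) \<in> R\<^sup>+"
      using g by (auto simp: Q_def)
    moreover have "R \<subseteq> P' \<times> P'"
      by (auto simp: R_def)
    ultimately obtain q where q: "q permutes P'" "(g, q g) \<in> R"
      "\<And>i. q i = i \<or> (i, q i) \<in> R"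
      using permutation_along_cycle by metis
    \<comment> \<open>Where \<open>q\<close> moves \<open>i\<close> it follows an edge, so the new
      code is allowed at \<open>i\<close> and differs from \<open>x i\<close>. Hence no hit is
      created, and the one at \<open>g\<close> is lost.\<close>
    have "\<sigma> (p (q i)) \<in> L i" if "i \<in> P" for i
      using q(3)[of i] p that by (auto simp: R_def \<tau>_def adm_def)
    then have "adm (p \<circ> q)"
      using p permutes_compose[OF permutes_subset[OF q(1) P'_P], of p] by (auto simp: adm_def)
    moreover have "card (hits (p \<circ> q)) < card (hits p)"
    proof (rule psubset_card_mono)
      show "finite (hits p)"
        using assms(1) by (simp add: hits_def)
      have "hits (p \<circ> q) \<subseteq> hits p"
      proof
        fix i assume "i \<in> hits (p \<circ> q)"
        then show "i \<in> hits p"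
          using q(3)[of i] by (auto simp: hits_def R_def \<tau>_def)
      qed
      moreover have "g \<in> hits p" "g \<notin> hits (p \<circ> q)"
        using hit q(2) g P'_P by (auto simp: hits_def R_def \<tau>_def)
      ultimately show "hits (p \<circ> q) \<subset> hits p"
        by blast
    qed
    ultimately show False
      using p_min by fastforce
  qed
  then show ?thesis
    using p P' unfolding adm_def closed_def \<tau>_def by (intro exI[of _ p] exI[of _ P']) auto
qed

text \<open>Induction on the number \<open>t\<close> of completed rounds. The answer may change with
  \<open>t\<close>, but the history it produces so far does not.\<close>

lemma adversary:
  assumes S: "is_strategy k n S" and "1 \<le> k" "k \<le> n" "t < k"
  shows "\<exists>\<sigma> P. \<sigma> ` {..<n} \<subseteq> {1..k} \<and> P \<subseteq> {..<n} \<and> P \<noteq> {} \<and>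
           (\<forall>i \<in> P. \<sigma> i \<in> {1..k} - (\<lambda>s. guess S (map \<sigma> [0..<n]) s ! i) ` {..<t} \<and>
                     {1..k} - (\<lambda>s. guess S (map \<sigma> [0..<n]) s ! i) ` {..<t} \<subseteq> \<sigma> ` P)"
  using \<open>t < k\<close>
proof (induction t)
  case 0
  \<comment> \<open>Positions \<open>0\<close> to \<open>k - 1\<close> receive the codes
    \<open>1\<close> to \<open>k\<close>, which needs \<open>k \<le> n\<close>; later positions
    repeat \<open>k\<close>.\<close>
  define \<sigma> where "\<sigma> i = min k (Suc i)" for i
  have "c \<in> \<sigma> ` {..<n}" if "c \<in> {1..k}" for c
    using that \<open>k \<le> n\<close> by (intro image_eqI[of _ _ "c - 1"]) (auto simp: \<sigma>_def)
  then show ?case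
    using assms(2,3) by (intro exI[of _ \<sigma>] exI[of _ "{..<n}"]) (auto simp: \<sigma>_def)
next
  case (Suc t)
  then obtain \<sigma> P where \<sigma>: "\<sigma> ` {..<n} \<subseteq> {1..k}" and P: "P \<subseteq> {..<n}" "P \<noteq> {}"
    and inv: "\<And>i. i \<in> P \<Longrightarrow> \<sigma> i \<in> {1..k} - (\<lambda>s. guess S (map \<sigma> [0..<n]) s ! i) ` {..<t}"
      "\<And>i. i \<in> P \<Longrightarrow> {1..k} - (\<lambda>s. guess S (map \<sigma> [0..<n]) s ! i) ` {..<t} \<subseteq> \<sigma> ` P"
    by (metis Suc_lessD)
  define y where "y = map \<sigma> [0..<n]"
  define L where "L i = {1..k} - (\<lambda>s. guess S y s ! i) ` {..<t}" for i
  define x where "x i = guess S y t ! i" for i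
  have L_step: "L i - {x i} = {1..k} - (\<lambda>s. guess S y s ! i) ` {..<Suc t}" for i
    by (auto simp: L_def x_def lessThan_Suc)
  \<comment> \<open>Fewer than \<open>k\<close> guesses cannot exhaust the \<open>k\<close> codes at
    a position.\<close>
  have "L i - {x i} \<noteq> {}" for i
  proof
    assume "L i - {x i} = {}"
    then have "{1..k} \<subseteq> (\<lambda>s. guess S y s ! i) ` {..<Suc t}"
      by (simp add: L_step)
    then have "card {1..k} \<le> card {..<Suc t}"
      by (rule surj_card_le[rotated]) simp
    then show False
      using Suc.prems by simp
  qed
  moreover have "finite P"
    using P finite_subset by blast
  moreover have "\<And>i. i \<in> P \<Longrightarrow> \<sigma> i \<in> L i" "\<And>i. i \<in> P \<Longrightarrow> L i \<subseteq> \<sigma> ` P"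
    using inv unfolding L_def y_def by blast+
  ultimately obtain p P' where p: "p permutes P" "\<And>i. i \<in> P \<Longrightarrow> \<sigma> (p i) \<in> L i"
    and P': "P' \<subseteq> P" "P' \<noteq> {}" "\<And>i. i \<in> P' \<Longrightarrow> \<sigma> (p i) \<noteq> x i"
      "\<And>i. i \<in> P' \<Longrightarrow> L i - {x i} \<subseteq> (\<lambda>j. \<sigma> (p j)) ` P'"
    using rearrangement_step[of P \<sigma> L x] P(2) by metis
  define z where "z = map (\<lambda>i. \<sigma> (p i)) [0..<n]"
  have p_n: "p permutes {..<n}"
    using p(1) P(1) by (rule permutes_subset)
  have "mset z = image_mset \<sigma> (image_mset p (mset_set {..<n}))"
    by (simp add: z_def lessThan_atLeast0 image_mset.compositionality comp_def)
  also have "\<dots> = mset y"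
    using p_n by (simp add: y_def permutes_image_mset lessThan_atLeast0)
  finally have mset: "mset y = mset z" by simp
  \<comment> \<open>Inside \<open>P\<close> the old and the new code are both unguessed, so neither
    answer gives green there; outside \<open>P\<close> nothing moves.\<close>
  have "feedback (guess S y s) y = feedback (guess S y s) z" if "s < t" for s
  proof (rule feedback_cong)
    have "length (guess S y s) = n"
      using S by (simp add: is_strategy_def guess_def codewords_def)
    then show "length (guess S y s) = length y" "length y = length z"
      by (simp_all add: y_def z_def)
    fix i assume "i < length (guess S y s)"
    then have i: "i < n"
      using \<open>length (guess S y s) = n\<close> by simp
    show "guess S y s ! i = y ! i \<longleftrightarrow> guess S y s ! i = z ! i"
    proof (cases "i \<in> P")
      case True
      then have "\<sigma> i \<in> L i" "\<sigma> (p i) \<in> L i"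
        using inv p(2) by (auto simp: L_def y_def)
      moreover have "guess S y s ! i \<notin> L i"
        using that by (auto simp: L_def)
      moreover have "y ! i = \<sigma> i" "z ! i = \<sigma> (p i)"
        using i by (simp_all add: y_def z_def)
      ultimately show ?thesis
        by metis
    next
      case False
      then show ?thesis
        using p(1) i by (simp add: y_def z_def permutes_not_in)
    qed
  qed (fact mset)
  \<comment> \<open>The case \<open>s = t\<close> is included: that guess depends only on the first
    \<open>t\<close> feedbacks.\<close>
  then have "guess S z s = guess S y s" if "s \<le> t" for s
    using play_cong[of s S y z] that by (simp add: guess_def)
  then have "{1..k} - (\<lambda>s. guess S z s ! i) ` {..<Suc t} = L i - {x i}" for i
    by (auto simp: L_step less_Suc_eq_le)
  moreover have "(\<lambda>i. \<sigma> (p i)) ` {..<n} \<subseteq> {1..k}"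
    using \<sigma> permutes_image[OF p_n] by (metis image_image)
  ultimately show ?case
    using P' P(1) p(2) unfolding z_def
    by (intro exI[of _ "\<lambda>i. \<sigma> (p i)"] exI[of _ P']) auto
qed

text \<open>At any position of the surviving \<open>P\<close>, the answer's code has not been
  guessed in the first \<open>m\<close> rounds, so none of these guesses is correct.\<close>

lemma not_solves_within:
  assumes "is_strategy k n S" "k \<le> n" "m < k"
  shows "\<not> solves_within k n m S"
proof
  assume solves: "solves_within k n m S"
  have "1 \<le> k"
    using assms(3) by simp
  obtain \<sigma> P where \<sigma>: "\<sigma> ` {..<n} \<subseteq> {1..k}" and P: "P \<subseteq> {..<n}" "P \<noteq> {}"
    and inv: "\<And>i. i \<in> P \<Longrightarrow> \<sigma> i \<notin> (\<lambda>s. guess S (map \<sigma> [0..<n]) s ! i) ` {..<m}"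
    using adversary[OF assms(1) \<open>1 \<le> k\<close> assms(2,3)] by (metis DiffD2)
  have "map \<sigma> [0..<n] \<in> codewords k n"
    using \<sigma> by (simp add: codewords_def lessThan_atLeast0)
  then obtain s where s: "s < m" "guess S (map \<sigma> [0..<n]) s = map \<sigma> [0..<n]"
    using solves by (auto simp: solves_within_def)
  obtain i where i: "i \<in> P" "i < n"
    using P by blast
  then have "guess S (map \<sigma> [0..<n]) s ! i = \<sigma> i"
    by (simp add: s(2))
  then show False
    using inv[OF i(1)] s(1) by (metis imageI lessThan_iff)
qed

theorem theorem1:
  fixes k n :: nat
  assumes "k \<ge> 1" and "n \<ge> 1" and "k \<le> n"
  shows "F k n = k"
  unfolding F_def
proof (rule Least_equality)
  show "\<exists>S. is_strategy k n S \<and> solves_within k n k S"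
    using assms(1) by (rule monochromatic_strategy)
  show "k \<le> m" if "\<exists>S. is_strategy k n S \<and> solves_within k n m S" for m
    using that not_solves_within assms(3) by (meson not_le)
qed

end
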